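(* There is a constant $C_J>0$, depending on the kernel $J$ but independent of $h$, such that the following holds. Suppose the time step $\tau>0$ satisfies $\tau\le\frac{2\gamma_0}{C_J\varepsilon^4}$, and let $(u_h^n)_{n\ge0}$ in $\mathcal{C}^{per}_{N\times N}$, with $(u_h^1\|\mathbf 1)=(u_h^0\|\mathbf 1)$, satisfy for all $n\ge1$ the BDF2 scheme $$\frac{3u_h^{n+1}-4u_h^n+u_h^{n-1}}{2\tau}=\Delta_h\omega_h^{n+1},\qquad \omega_h^{n+1}=F'(u_h^{n+1})+\varepsilon^2[J\circledast\mathbf 1]u_h^{n+1}-\varepsilon^2[J\circledast u_h^{n+1}].$$ Then, with $\delta u_h^n:=u_h^n-u_h^{n-1}$ and $\widetilde E_h(u_h,v_h):=E_h(u_h)+\frac{1}{4\tau}\|v_h\|_{-1}^2$, $$\widetilde E_h(u_h^{n+1},\delta u_h^{n+1})\le\widetilde E_h(u_h^n,\delta u_h^n)\qquad\text{for all } n\ge1.$$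
   Context: Setting. $\Omega=(0,L)\times(0,L)$, $h=L/N$ with $N\in\mathbb{Z}^+$, and $\varepsilon>0$. The kernel $J:\mathbb{R}^2\to\mathbb{R}$ is $C^\infty$, $\Omega$-periodic ($L$-periodic in each variable) and even ($J(\mathbf x)=J(-\mathbf x)$), with $J*1=\int_\Omega J\,d\mathbf x>0$. $\mathcal{C}^{per}_{N\times N}$ is the finite-dimensional space of real periodic cell-centered grid functions $\phi=(\phi_{i,j})$ (values at $((i-\tfrac12)h,(j-\tfrac12)h)$), extended $N$-periodically in both indices $i,j\in\mathbb{Z}$. $\mathbf 1$ is the constant grid function $1$; products, powers and $F(u_h),F'(u_h)$ are taken componentwise. $(\phi\|\psi)=\sum_{i,j=1}^N\phi_{i,j}\psi_{i,j}$ and $\|\phi\|_2^2=h^2(\phi\|\phi)$. Discrete Laplacian: $(\Delta_h\phi)_{i,j}=h^{-2}(\phi_{i+1,j}+\phi_{i-1,j}+\phi_{i,j+1}+\phi_{i,j-1}-4\phi_{i,j})$. On the zero-mean space $\mathcal M_h^0=\{u\in\mathcal{C}^{per}_{N\times N}:(u\|\mathbf 1)=0\}$, $-\Delta_h$ is self-adjoint positive definite, hence invertible, and $\|u\|_{-1}:=\sqrt{h^2((-\Delta_h)^{-1}u\|u)}$ for $u\in\mathcal M_h^0$. (The increments $\delta u_h^n$ lie in $\mathcal M_h^0$.) Discrete convolution: with $J_{k+\frac12,l+\frac12}:=J(kh,lh)$, $[J\circledast\phi]_{i,j}=h^2\sum_{k=1}^N\sum_{l=1}^N J_{k+\frac12,l+\frac12}\,\phi_{i-k,j-l}$.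 $[J\circledast\mathbf 1]$ is a constant grid function, identified with the number $h^2\sum_{k,l=1}^N J(kh,lh)$. Standing assumption: $\gamma:=\varepsilon^2(J*1)-1>0$ and its discrete analogue $\gamma_0:=\varepsilon^2[J\circledast\mathbf 1]-1>0$. Potential: $F(r)=\frac14(r^2-1)^2$. Discrete energy: $E_h(u_h)=h^2(F(u_h)\|\mathbf 1)+\frac{\varepsilon^2[J\circledast\mathbf 1]}{2}\|u_h\|_2^2-\frac{\varepsilon^2}{2}h^2(u_h\|[J\circledast u_h])$. *)

theory Defs
  imports "HOL-Analysis.Analysis"
begin

(* C_k k f: f is k times continuously differentiable on the whole space; each
   directional derivative x |-> Df(x)v must again be of class C^(k-1). *)
primrec C_k :: "nat \<Rightarrow> ('a::euclidean_space \<Rightarrow> real) \<Rightarrow> bool" where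
  "C_k 0 f \<longleftrightarrow> continuous_on UNIV f"
| "C_k (Suc k) f \<longleftrightarrow>
     f differentiable_on UNIV \<and> (\<forall>v. C_k k (\<lambda>x. frechet_derivative f (at x) v))"

definition smooth :: "('a::euclidean_space \<Rightarrow> real) \<Rightarrow> bool" where
  "smooth f \<longleftrightarrow> (\<forall>k. C_k k f)"

definition square :: "real \<Rightarrow> (real \<times> real) set" where
  "square L = {0<..<L} \<times> {0<..<L}"

definition periodic2 :: "real \<Rightarrow> (real \<times> real \<Rightarrow> real) \<Rightarrow> bool" where
  "periodic2 L J \<longleftrightarrow> (\<forall>x y. J (x + L, y) = J (x, y) \<and> J (x, y + L) = J (x, y))"

(* The number J*1. *)
definition conv_one :: "real \<Rightarrow> (real \<times> real \<Rightarrow> real) \<Rightarrow> real" where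
  "conv_one L J = (LINT x:square L|lborel. J x)"

(* Cell-centred grid functions; phi i j is the value at ((i - 1/2) h, (j - 1/2) h).
   Periodicity is imposed separately, by membership in per_grid. *)
type_synonym grid = "int \<Rightarrow> int \<Rightarrow> real"

definition per_grid :: "nat \<Rightarrow> grid set" where
  "per_grid N = {\<phi>. \<forall>i j. \<phi> (i + int N) j = \<phi> i j \<and> \<phi> i (j + int N) = \<phi> i j}"

definition one_grid :: grid where
  "one_grid = (\<lambda>i j. 1)"

definition mesh :: "real \<Rightarrow> nat \<Rightarrow> real" where
  "mesh L N = L / real N"

(* The unweighted form (phi || psi), without the factor h^2. *)
definition grid_inner :: "nat \<Rightarrow> grid \<Rightarrow> grid \<Rightarrow> real" where
  "grid_inner N \<phi> \<psi> = (\<Sum>i=1..int N. \<Sum>j=1..int N. \<phi> i j * \<psi> i j)"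

definition grid_norm2 :: "real \<Rightarrow> nat \<Rightarrow> grid \<Rightarrow> real" where
  "grid_norm2 L N \<phi> = sqrt ((mesh L N)\<^sup>2 * grid_inner N \<phi> \<phi>)"

definition laplace_h :: "real \<Rightarrow> nat \<Rightarrow> grid \<Rightarrow> grid" where
  "laplace_h L N \<phi> = (\<lambda>i j.
     (\<phi> (i + 1) j + \<phi> (i - 1) j + \<phi> i (j + 1) + \<phi> i (j - 1) - 4 * \<phi> i j) / (mesh L N)\<^sup>2)"

definition neg_laplace_h :: "real \<Rightarrow> nat \<Rightarrow> grid \<Rightarrow> grid" where
  "neg_laplace_h L N \<phi> = (\<lambda>i j. - laplace_h L N \<phi> i j)"

definition zero_mean :: "nat \<Rightarrow> grid set" where
  "zero_mean N = {u \<in> per_grid N. grid_inner N u one_grid = 0}"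

(* Meaningful only on zero_mean N, where neg_laplace_h is a bijection of
   zero_mean N onto itself. *)
definition inv_neg_laplace_h :: "real \<Rightarrow> nat \<Rightarrow> grid \<Rightarrow> grid" where
  "inv_neg_laplace_h L N = inv_into (zero_mean N) (neg_laplace_h L N)"

definition norm_m1 :: "real \<Rightarrow> nat \<Rightarrow> grid \<Rightarrow> real" where
  "norm_m1 L N u = sqrt ((mesh L N)\<^sup>2 * grid_inner N (inv_neg_laplace_h L N u) u)"

(* Kernel values are taken at the nodes (k h, l h), not at cell centres. *)
definition dconv :: "real \<Rightarrow> nat \<Rightarrow> (real \<times> real \<Rightarrow> real) \<Rightarrow> grid \<Rightarrow> grid" where
  "dconv L N J \<phi> = (\<lambda>i j. (mesh L N)\<^sup>2 *
     (\<Sum>k=1..int N. \<Sum>l=1..int N.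
        J (of_int k * mesh L N, of_int l * mesh L N) * \<phi> (i - k) (j - l)))"

(* The constant grid function dconv L N J one_grid, as a number. *)
definition dconv_one :: "real \<Rightarrow> nat \<Rightarrow> (real \<times> real \<Rightarrow> real) \<Rightarrow> real" where
  "dconv_one L N J = (mesh L N)\<^sup>2 *
     (\<Sum>k=1..int N. \<Sum>l=1..int N. J (of_int k * mesh L N, of_int l * mesh L N))"

definition gamma_cont :: "real \<Rightarrow> (real \<times> real \<Rightarrow> real) \<Rightarrow> real \<Rightarrow> real" where
  "gamma_cont L J \<epsilon> = \<epsilon>\<^sup>2 * conv_one L J - 1"

definition gamma_disc :: "real \<Rightarrow> nat \<Rightarrow> (real \<times> real \<Rightarrow> real) \<Rightarrow> real \<Rightarrow> real" where
  "gamma_disc L N J \<epsilon> = \<epsilon>\<^sup>2 * dconv_one L N J - 1"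

definition potential :: "real \<Rightarrow> real" where
  "potential r = (r\<^sup>2 - 1)\<^sup>2 / 4"

definition energy_h :: "real \<Rightarrow> nat \<Rightarrow> (real \<times> real \<Rightarrow> real) \<Rightarrow> real \<Rightarrow> grid \<Rightarrow> real" where
  "energy_h L N J \<epsilon> u =
     (mesh L N)\<^sup>2 * grid_inner N (\<lambda>i j. potential (u i j)) one_grid
     + \<epsilon>\<^sup>2 * dconv_one L N J / 2 * (grid_norm2 L N u)\<^sup>2
     - \<epsilon>\<^sup>2 / 2 * ((mesh L N)\<^sup>2 * grid_inner N u (dconv L N J u))"

definition modified_energy_h ::
    "real \<Rightarrow> nat \<Rightarrow> (real \<times> real \<Rightarrow> real) \<Rightarrow> real \<Rightarrow> real \<Rightarrow> grid \<Rightarrow> grid \<Rightarrow> real" where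
  "modified_energy_h L N J \<epsilon> \<tau> u v = energy_h L N J \<epsilon> u + 1 / (4 * \<tau>) * (norm_m1 L N v)\<^sup>2"

definition chem_potential ::
    "real \<Rightarrow> nat \<Rightarrow> (real \<times> real \<Rightarrow> real) \<Rightarrow> real \<Rightarrow> grid \<Rightarrow> grid" where
  "chem_potential L N J \<epsilon> u = (\<lambda>i j.
     deriv potential (u i j) + \<epsilon>\<^sup>2 * dconv_one L N J * u i j - \<epsilon>\<^sup>2 * dconv L N J u i j)"

(* Used for n >= 1 only; delta u 0 is a junk value because of truncated subtraction. *)
definition delta :: "(nat \<Rightarrow> grid) \<Rightarrow> nat \<Rightarrow> grid" where
  "delta u n = (\<lambda>i j. u n i j - u (n - 1) i j)"

definition bdf2_step ::
    "real \<Rightarrow> nat \<Rightarrow> (real \<times> real \<Rightarrow> real) \<Rightarrow> real \<Rightarrow> real \<Rightarrow> (nat \<Rightarrow> grid) \<Rightarrow> nat \<Rightarrow> bool" where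
  "bdf2_step L N J \<epsilon> \<tau> u n \<longleftrightarrow>
     (\<forall>i j. (3 * u (n + 1) i j - 4 * u n i j + u (n - 1) i j) / (2 * \<tau>)
            = laplace_h L N (chem_potential L N J \<epsilon> (u (n + 1))) i j)"

end

theory Submission
  imports Defs
begin

text \<open>
  Write \<open>w = \<delta>u\<^bsup>n+1\<^esup>\<close>, \<open>v = \<delta>u\<^bsup>n\<^esup>\<close>. Testing the scheme with \<open>p = (-\<Delta>)\<^bsup>-1\<^esup> w\<close> and using
  \<open>2 \<langle>v, w\<rangle> \<le> \<parallel>v\<parallel>\<^sup>2 + \<parallel>w\<parallel>\<^sup>2\<close> in the \<open>(-1)\<close>-norm gives
  \<open>h\<^sup>2 (\<omega> | w) \<le> (\<parallel>v\<parallel>\<^sup>2 - 5 \<parallel>w\<parallel>\<^sup>2) / (4\<tau>)\<close>. Since \<open>F'' \<ge> -1\<close> and the rest of the energy is quadratic,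
  the energy increment is at most
  \<open>h\<^sup>2 (\<omega> | w) - (\<gamma>\<^sub>0/2) h\<^sup>2 (w | w) + (\<epsilon>\<^sup>2/2) h\<^sup>2 (w | J * w)\<close>. The last inner product equals the
  Dirichlet form of \<open>p\<close> and \<open>J * w\<close>; as \<open>J\<close> is Lipschitz, the Dirichlet energy of \<open>J * w\<close> is at most
  \<open>M h\<^sup>2 (w | w)\<close> with \<open>M\<close> independent of \<open>h\<close>, and Young's inequality absorbs the mixed term into
  \<open>(\<gamma>\<^sub>0/2) h\<^sup>2 (w | w)\<close> and \<open>\<parallel>w\<parallel>\<^sup>2/\<tau>\<close> when \<open>\<tau> \<le> 8\<gamma>\<^sub>0/(M \<epsilon>\<^sup>4)\<close>, so that \<open>C\<^sub>J = M/4\<close> works.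
\<close>

section \<open>Sums over one period\<close>

text \<open>Taking the whole summand as one grid function lets the linearity, shift and exchange
  rules act on products, which \<open>grid_inner\<close> splits into two arguments.\<close>

definition gsum :: "nat \<Rightarrow> grid \<Rightarrow> real" where
  "gsum N f = (\<Sum>i=1..int N. \<Sum>j=1..int N. f i j)"

lemma grid_inner_gsum: "grid_inner N f g = gsum N (\<lambda>i j. f i j * g i j)"
  by (simp add: grid_inner_def gsum_def)

lemma grid_inner_commute: "grid_inner N f g = grid_inner N g f"
  by (simp add: grid_inner_gsum mult.commute)

lemma gsum_add: "gsum N (\<lambda>i j. f i j + g i j) = gsum N f + gsum N g"
  by (simp add: gsum_def sum.distrib)

lemma gsum_diff: "gsum N (\<lambda>i j. f i j - g i j) = gsum N f - gsum N g"
  by (simp add: gsum_def sum_subtractf)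

lemma gsum_uminus: "gsum N (\<lambda>i j. - f i j) = - gsum N f"
  by (simp add: gsum_def sum_negf)

lemma gsum_mult_left: "gsum N (\<lambda>i j. c * f i j) = c * gsum N f"
  by (simp add: gsum_def sum_distrib_left)

lemma gsum_divide: "gsum N (\<lambda>i j. f i j / c) = gsum N f / c"
  by (simp add: gsum_def sum_divide_distrib)

lemma gsum_const: "gsum N (\<lambda>i j. c) = (real N)\<^sup>2 * c"
  by (simp add: gsum_def power2_eq_square)

lemma gsum_mono:
  assumes "\<And>i j. 1 \<le> i \<Longrightarrow> i \<le> int N \<Longrightarrow> 1 \<le> j \<Longrightarrow> j \<le> int N \<Longrightarrow> f i j \<le> g i j"
  shows "gsum N f \<le> gsum N g"
  unfolding gsum_def using assms by (intro sum_mono) auto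

lemma gsum_cong:
  assumes "\<And>i j. 1 \<le> i \<Longrightarrow> i \<le> int N \<Longrightarrow> 1 \<le> j \<Longrightarrow> j \<le> int N \<Longrightarrow> f i j = g i j"
  shows "gsum N f = gsum N g"
  unfolding gsum_def using assms by (intro sum.cong refl) auto

lemma gsum_nonneg: "(\<And>i j. 0 \<le> f i j) \<Longrightarrow> 0 \<le> gsum N f"
  unfolding gsum_def by (intro sum_nonneg) auto

lemma gsum_prod: "gsum N f = (\<Sum>(i,j)\<in>{1..int N} \<times> {1..int N}. f i j)"
  by (simp add: gsum_def sum.cartesian_product)

lemma gsum_swap:
  "gsum N (\<lambda>i j. gsum N (\<lambda>k l. f i j k l)) = gsum N (\<lambda>k l. gsum N (\<lambda>i j. f i j k l))"
  unfolding gsum_prod case_prod_unfold by (rule sum.swap)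

text \<open>Cauchy-Schwarz against the constant 1; the factor N^2 counts the grid points.\<close>

lemma gsum_square_le: "(gsum N f)\<^sup>2 \<le> (real N)\<^sup>2 * gsum N (\<lambda>i j. (f i j)\<^sup>2)"
  using sum_squared_le_sum_of_squares[of "\<lambda>(i,j). f i j" "{1..int N} \<times> {1..int N}"]
  by (simp add: gsum_prod case_prod_unfold card_cartesian_product power2_eq_square mult.commute)

section \<open>Translation and reflection invariance of periodic sums\<close>

lemma periodic_sum_shift1:
  fixes f :: "int \<Rightarrow> real"
  assumes "\<And>i. f (i + int N) = f i"
  shows "(\<Sum>i=1..int N. f (i + 1)) = (\<Sum>i=1..int N. f i)"
proof (cases "N = 0")
  case False
  have "(\<Sum>i=1..int N. f (i + 1)) = (\<Sum>i=2..int N+1. f i)"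
    by (rule sum.reindex_bij_witness[of _ "\<lambda>i. i - 1" "\<lambda>i. i + 1"]) auto
  \<comment> \<open>The shifted window trades index 1 for N + 1, where periodicity gives the same
    value.\<close>
  also have "{2..int N + 1} = insert (int N + 1) {2..int N}"
    using False by auto
  also have "sum f \<dots> = f (1 + int N) + sum f {2..int N}"
    by (simp add: add.commute)
  also have "\<dots> = sum f (insert 1 {2..int N})"
    by (simp add: assms)
  also have "insert 1 {2..int N} = {1..int N}"
    using False by auto
  finally show ?thesis .
qed simp

lemma periodic_sum_shift:
  fixes f :: "int \<Rightarrow> real"
  assumes per: "\<And>i. f (i + int N) = f i"
  shows "(\<Sum>i=1..int N. f (i + m)) = (\<Sum>i=1..int N. f i)"
proof -
  have step: "(\<Sum>i=1..int N. f (i + (k + 1))) = (\<Sum>i=1..int N. f (i + k))" for k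
    using periodic_sum_shift1[of "\<lambda>i. f (i + k)" N] per[of "i + k" for i]
    by (simp add: algebra_simps)
  show ?thesis
  proof (induction m rule: int_induct[where k = 0])
    case (step1 i)
    then show ?case by (simp only: step)
  next
    case (step2 i)
    then show ?case using step[of "i - 1"] by simp
  qed simp
qed

lemma periodic_sum_reflect:
  fixes f :: "int \<Rightarrow> real"
  assumes "\<And>i. f (i + int N) = f i"
  shows "(\<Sum>i=1..int N. f (- i)) = (\<Sum>i=1..int N. f i)"
proof -
  \<comment> \<open>Reversing the order of summation by i -> N + 1 - i turns the reflection into a
    shift by -N - 1.\<close>
  have "(\<Sum>i=1..int N. f (- i)) = (\<Sum>i=1..int N. f (i + (- int N - 1)))"
    by (rule sum.reindex_bij_witness[of _ "\<lambda>i. int N + 1 - i" "\<lambda>i. int N + 1 - i"]) auto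
  then show ?thesis
    using periodic_sum_shift[of f N, OF assms] by simp
qed

lemma per_gridD1: "f \<in> per_grid N \<Longrightarrow> f (i + int N) j = f i j"
  and per_gridD2: "f \<in> per_grid N \<Longrightarrow> f i (j + int N) = f i j"
  by (auto simp: per_grid_def)

lemma per_grid_shift: "f \<in> per_grid N \<Longrightarrow> (\<lambda>i j. f (i + a) (j + b)) \<in> per_grid N"
  by (simp add: per_grid_def add.commute add.left_commute add.assoc)
    (metis add.commute add.left_commute)

lemma gsum_shift:
  assumes "f \<in> per_grid N"
  shows "gsum N (\<lambda>i j. f (i + a) (j + b)) = gsum N f"
proof -
  have "(\<Sum>j=1..int N. f i (j + b)) = (\<Sum>j=1..int N. f i j)" for i
    using per_gridD2[OF assms] by (rule periodic_sum_shift)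
  moreover have "(\<Sum>i=1..int N. \<Sum>j=1..int N. f (i + a) j) = (\<Sum>i=1..int N. \<Sum>j=1..int N. f i j)"
    by (rule periodic_sum_shift[where f = "\<lambda>i. \<Sum>j=1..int N. f i j"])
      (simp add: per_gridD1[OF assms])
  ultimately show ?thesis by (simp add: gsum_def)
qed

lemma gsum_reflect:
  assumes "f \<in> per_grid N"
  shows "gsum N (\<lambda>i j. f (- i) (- j)) = gsum N f"
proof -
  have "(\<Sum>j=1..int N. f i (- j)) = (\<Sum>j=1..int N. f i j)" for i
    using per_gridD2[OF assms] by (rule periodic_sum_reflect)
  moreover have "(\<Sum>i=1..int N. \<Sum>j=1..int N. f (- i) j) = (\<Sum>i=1..int N. \<Sum>j=1..int N. f i j)"
    by (rule periodic_sum_reflect[where f = "\<lambda>i. \<Sum>j=1..int N. f i j"])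
      (simp add: per_gridD1[OF assms])
  ultimately show ?thesis by (simp add: gsum_def)
qed

section \<open>The discrete Dirichlet form\<close>

text \<open>This is h^2 times the inner product of the forward-difference gradients. In two
  dimensions the weight h^2 cancels the two factors 1/h, so no mesh size appears.\<close>

definition dirichlet :: "nat \<Rightarrow> grid \<Rightarrow> grid \<Rightarrow> real" where
  "dirichlet N f g = gsum N (\<lambda>i j. (f (i + 1) j - f i j) * (g (i + 1) j - g i j)
     + (f i (j + 1) - f i j) * (g i (j + 1) - g i j))"

lemma dirichlet_commute: "dirichlet N f g = dirichlet N g f"
  by (simp add: dirichlet_def mult.commute)

lemma dirichlet_nonneg: "0 \<le> dirichlet N f f"
  unfolding dirichlet_def by (rule gsum_nonneg) simp

text \<open>Young's inequality for each difference separately. The weight stays free: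
  \<open>s = 1\<close> will balance two successive increments, another choice the convolution
  term.\<close>

lemma dirichlet_Young:
  assumes "s > 0"
  shows "dirichlet N f g \<le> s / 2 * dirichlet N f f + 1 / (2 * s) * dirichlet N g g"
proof -
  have young: "a * b \<le> s / 2 * (a * a) + 1 / (2 * s) * (b * b)" for a b :: real
  proof -
    have "0 \<le> (s * a - b)\<^sup>2 / (2 * s)" using assms by simp
    also have "\<dots> = s / 2 * (a * a) + 1 / (2 * s) * (b * b) - a * b"
      using assms by (simp add: field_simps power2_eq_square)
    finally show ?thesis by simp
  qed
  have "a * b + c * d \<le> s / 2 * (a * a + c * c) + 1 / (2 * s) * (b * b + d * d)" for a b c d :: real
    using young[of a b] young[of c d] by (simp only: distrib_left)
  then show ?thesis
    unfolding dirichlet_def gsum_mult_left[symmetric] gsum_add[symmetric] by (intro gsum_mono)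
qed

text \<open>Summation by parts. Products of shifted periodic functions are periodic, so translating
  a full period moves the differences off \<open>g\<close> and leaves no boundary terms.\<close>

lemma dirichlet_eq_grid_inner:
  assumes f: "f \<in> per_grid N" and g: "g \<in> per_grid N" and h: "mesh L N \<noteq> 0"
  shows "dirichlet N f g = (mesh L N)\<^sup>2 * grid_inner N (neg_laplace_h L N f) g"
proof -
  have prod: "(\<lambda>i j. f (i + a) (j + b) * g (i + c) (j + d)) \<in> per_grid N" for a b c d
    using per_grid_shift[OF f, of a b] per_grid_shift[OF g, of c d] by (simp add: per_grid_def)
  have s1: "gsum N (\<lambda>i j. f (i + 1) j * g (i + 1) j) = gsum N (\<lambda>i j. f i j * g i j)"
    using gsum_shift[OF prod[of 0 0 0 0], of 1 0] by simp
  have s2: "gsum N (\<lambda>i j. f i (j + 1) * g i (j + 1)) = gsum N (\<lambda>i j. f i j * g i j)"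
    using gsum_shift[OF prod[of 0 0 0 0], of 0 1] by simp
  have s3: "gsum N (\<lambda>i j. f i j * g (i + 1) j) = gsum N (\<lambda>i j. f (i - 1) j * g i j)"
    using gsum_shift[OF prod[of "-1" 0 0 0], of 1 0] by simp
  have s4: "gsum N (\<lambda>i j. f i j * g i (j + 1)) = gsum N (\<lambda>i j. f i (j - 1) * g i j)"
    using gsum_shift[OF prod[of 0 "-1" 0 0], of 0 1] by simp
  have "(mesh L N)\<^sup>2 * grid_inner N (neg_laplace_h L N f) g
      = gsum N (\<lambda>i j. (mesh L N)\<^sup>2 * (neg_laplace_h L N f i j * g i j))"
    by (simp add: grid_inner_gsum gsum_mult_left)
  also have "\<dots> = gsum N (\<lambda>i j. 4 * (f i j * g i j) - f (i + 1) j * g i j - f (i - 1) j * g i j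
       - f i (j + 1) * g i j - f i (j - 1) * g i j)"
    using h by (intro gsum_cong) (simp add: neg_laplace_h_def laplace_h_def field_simps)
  also have "\<dots> = dirichlet N f g"
    unfolding dirichlet_def by (simp add: left_diff_distrib right_diff_distrib gsum_add gsum_diff gsum_uminus gsum_mult_left s1 s2 s3 s4)
  finally show ?thesis by simp
qed

section \<open>Solvability of the discrete Poisson problem\<close>

text \<open>Gaussian elimination by induction on the set of equations: a zero row is dropped, and
  any other row removes one equation together with one unknown, so the unknowns stay in
  excess.\<close>

lemma underdetermined_homogeneous_system:
  fixes a :: "'i \<Rightarrow> 'k \<Rightarrow> 'f::field"
  assumes "finite I" "finite K" "card I < card K"
  shows "\<exists>x. (\<exists>k\<in>K. x k \<noteq> 0) \<and> (\<forall>i\<in>I. (\<Sum>k\<in>K. a i k * x k) = 0)"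
  using assms
proof (induction I arbitrary: K a rule: finite_induct)
  case empty
  then have "K \<noteq> {}" by auto
  then show ?case by (intro exI[of _ "\<lambda>_. 1"]) auto
next
  case (insert r I)
  show ?case
  proof (cases "\<forall>k\<in>K. a r k = 0")
    case True
    from insert have "card I < card K" by simp
    from insert.IH[OF \<open>finite K\<close> this, of a] True show ?thesis by auto
  next
    case False
    then obtain p where p: "p \<in> K" "a r p \<noteq> 0" by auto
    have K: "(\<Sum>k\<in>K. g k) = g p + (\<Sum>k\<in>K - {p}. g k)" for g :: "'k \<Rightarrow> 'f"
      using p insert.prems by (simp add: sum.remove)
    have "card I < card (K - {p})" using insert p by simp
    \<comment> \<open>These are the coefficients left after row \<open>r\<close> has been used to
      eliminate the unknown \<open>p\<close>.\<close>
    from insert.IH[OF _ this, of "\<lambda>i k. a i k - a i p * a r k / a r p"] insert.prems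
    obtain x where x: "\<exists>k\<in>K - {p}. x k \<noteq> 0"
      "\<And>i. i \<in> I \<Longrightarrow> (\<Sum>k\<in>K - {p}. (a i k - a i p * a r k / a r p) * x k) = 0"
      by auto
    define s where "s = (\<Sum>k\<in>K - {p}. a r k * x k)"
    \<comment> \<open>The value at \<open>p\<close> is the one that satisfies row \<open>r\<close>;
      with it the reduced rows become the original ones.\<close>
    define y where "y = x(p := - s / a r p)"
    have y: "(\<Sum>k\<in>K. a i k * y k) = - a i p * s / a r p + (\<Sum>k\<in>K - {p}. a i k * x k)" for i
      unfolding K by (simp add: y_def)
    have "(\<Sum>k\<in>K - {p}. a i k * x k) = a i p * s / a r p" if "i \<in> I" for i
      using x(2)[OF that]
      by (simp add: s_def left_diff_distrib sum_subtractf sum_distrib_left sum_divide_distrib mult.assoc)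
    then have "(\<Sum>k\<in>K. a i k * y k) = 0" if "i \<in> insert r I" for i
      using that p by (auto simp: y s_def[symmetric])
    moreover have "\<exists>k\<in>K. y k \<noteq> 0" using x(1) by (auto simp: y_def)
    ultimately show ?thesis by blast
  qed
qed

text \<open>The column \<open>- b\<close>, indexed by \<open>None\<close>, makes the homogeneous
  system underdetermined. By \<open>inj\<close> a nontrivial solution has a nonzero
  \<open>None\<close> component, and dividing by it solves the inhomogeneous system.\<close>

lemma square_system_solvable:
  fixes a :: "'i \<Rightarrow> 'i \<Rightarrow> 'f::field"
  assumes I: "finite I"
    and inj: "\<And>x. (\<And>i. i \<in> I \<Longrightarrow> (\<Sum>k\<in>I. a i k * x k) = 0) \<Longrightarrow> (\<And>k. k \<in> I \<Longrightarrow> x k = 0)"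
  obtains x where "\<And>i. i \<in> I \<Longrightarrow> (\<Sum>k\<in>I. a i k * x k) = b i"
proof -
  define K where "K = insert None (Some ` I)"
  define A where "A i k = (case k of None \<Rightarrow> - b i | Some k' \<Rightarrow> a i k')" for i k
  have K: "(\<Sum>k\<in>K. A i k * y k) = - b i * y None + (\<Sum>k\<in>I. a i k * y (Some k))" for i and y :: "'i option \<Rightarrow> 'f"
    unfolding K_def A_def using I by (subst sum.insert) (auto simp: sum.reindex)
  have "card I < card K" unfolding K_def using I by (simp add: card_image)
  with underdetermined_homogeneous_system[of I K A] I
  obtain y where y: "\<exists>k\<in>K. y k \<noteq> 0" "\<And>i. i \<in> I \<Longrightarrow> (\<Sum>k\<in>K. A i k * y k) = 0"
    by (auto simp: K_def)
  have "y None \<noteq> 0"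
  proof
    assume 0: "y None = 0"
    then have "y (Some k) = 0" if "k \<in> I" for k
      using inj[of "\<lambda>k. y (Some k)"] y(2) that by (simp add: K)
    with 0 y(1) show False by (auto simp: K_def)
  qed
  then have "(\<Sum>k\<in>I. a i k * (y (Some k) / y None)) = b i" if "i \<in> I" for i
    using y(2)[OF that] unfolding K by (simp add: sum_divide_distrib[symmetric] eq_divide_eq divide_eq_eq)
  then show ?thesis by (rule that)
qed


section \<open>Periodic grid functions determined by one period\<close>

text \<open>The residue of \<open>i\<close> modulo N taken in 1..N instead of 0..N-1, to match the
  summation window.\<close>

definition rep :: "nat \<Rightarrow> int \<Rightarrow> int" where
  "rep N i = (i - 1) mod int N + 1"

lemma rep_add [simp]: "rep N (i + int N) = rep N i"
  using mod_add_self2[of "i - 1" "int N"] by (simp add: rep_def algebra_simps)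

lemma rep_id: "1 \<le> i \<Longrightarrow> i \<le> int N \<Longrightarrow> rep N i = i"
  by (simp add: rep_def)

lemma rep_range: "N \<ge> 1 \<Longrightarrow> 1 \<le> rep N i \<and> rep N i \<le> int N"
  using pos_mod_bound[of "int N" "i - 1"] pos_mod_sign[of "int N" "i - 1"]
  by (simp add: rep_def del: pos_mod_bound pos_mod_sign)

lemma periodic_rep:
  fixes f :: "int \<Rightarrow> real"
  assumes "\<And>i. f (i + int N) = f i"
  shows "f (rep N i) = f i"
proof -
  have *: "f (k + m * int N) = f k" for k m
  proof (induction m rule: int_induct[where k = 0])
    case (step1 m)
    then show ?case using assms[of "k + m * int N"] by (simp add: algebra_simps)
  next
    case (step2 m)
    then show ?case using assms[of "k + (m - 1) * int N"] by (simp add: algebra_simps)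
  qed simp
  have "i = rep N i + (i - 1) div int N * int N"
    by (simp add: rep_def)
  then show ?thesis using *[of "rep N i" "(i - 1) div int N"] by simp
qed

lemma per_grid_rep: "f \<in> per_grid N \<Longrightarrow> f (rep N i) (rep N j) = f i j"
  using periodic_rep[of "\<lambda>i. f i (rep N j)" N i] periodic_rep[of "f i" N j]
  by (simp add: per_grid_def)

lemma per_grid_eqI:
  assumes "N \<ge> 1" "f \<in> per_grid N" "g \<in> per_grid N"
    and "\<And>i j. 1 \<le> i \<Longrightarrow> i \<le> int N \<Longrightarrow> 1 \<le> j \<Longrightarrow> j \<le> int N \<Longrightarrow> f i j = g i j"
  shows "f = g"
proof (intro ext)
  fix i j
  show "f i j = g i j"
    using per_grid_rep[OF assms(2), of i j] per_grid_rep[OF assms(3), of i j]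
      assms(4)[of "rep N i" "rep N j"] rep_range[OF assms(1)] by simp
qed

lemma neg_laplace_h_per_grid:
  assumes "f \<in> per_grid N"
  shows "neg_laplace_h L N f \<in> per_grid N"
proof -
  have "f (i + int N + a) j = f (i + a) j" "f i (j + int N + a) = f i (j + a)" for i j a
    using per_gridD1[OF assms, of "i + a" j] per_gridD2[OF assms, of i "j + a"]
    by (simp_all add: ac_simps)
  from this(1)[of _ 1] this(1)[of _ "-1"] this(2)[of _ _ 1] this(2)[of _ _ "-1"] show ?thesis
    unfolding per_grid_def neg_laplace_h_def laplace_h_def
    by (simp add: per_gridD1[OF assms] per_gridD2[OF assms])
qed

lemma one_grid_per_grid: "one_grid \<in> per_grid N"
  by (simp add: one_grid_def per_grid_def)

section \<open>Kernel and range of the discrete Laplacian\<close>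

text \<open>Summation by parts against the constant 1, all of whose differences vanish.\<close>

lemma gsum_neg_laplace_h:
  assumes "f \<in> per_grid N" "mesh L N \<noteq> 0"
  shows "gsum N (neg_laplace_h L N f) = 0"
  using dirichlet_eq_grid_inner[OF assms(1) one_grid_per_grid assms(2)] assms(2)
  by (simp add: dirichlet_def one_grid_def grid_inner_gsum gsum_const)

text \<open>A vanishing sum of squares kills every forward difference, so the value can be carried
  to (1,1) by walking first in \<open>i\<close>, then in \<open>j\<close>.\<close>

lemma dirichlet_zero_imp_constant:
  assumes "dirichlet N f f = 0" "1 \<le> i" "i \<le> int N" "1 \<le> j" "j \<le> int N"
  shows "f i j = f 1 1"
proof -
  have D: "(\<Sum>(i,j)\<in>{1..int N} \<times> {1..int N}. (f (i + 1) j - f i j) * (f (i + 1) j - f i j)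
     + (f i (j + 1) - f i j) * (f i (j + 1) - f i j)) = 0"
    using assms(1) by (simp add: dirichlet_def gsum_prod)
  have step: "f (i + 1) j = f i j" "f i (j + 1) = f i j" if "1 \<le> i" "i \<le> int N" "1 \<le> j" "j \<le> int N" for i j
  proof -
    have "(f (i + 1) j - f i j) * (f (i + 1) j - f i j)
       + (f i (j + 1) - f i j) * (f i (j + 1) - f i j) = 0"
      using D that by (subst (asm) sum_nonneg_eq_0_iff) (auto simp: sum_squares_eq_zero_iff)
    then show "f (i + 1) j = f i j" "f i (j + 1) = f i j"
      by (simp_all add: sum_squares_eq_zero_iff)
  qed
  have "i \<le> int N \<longrightarrow> f i j = f 1 j"
    using assms(2) by (induction i rule: int_ge_induct) (use step assms(4,5) in auto)
  moreover have "j \<le> int N \<longrightarrow> f 1 j = f 1 1"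
    using assms(4) by (induction j rule: int_ge_induct) (use step assms(2,3) in auto)
  ultimately show ?thesis using assms by simp
qed

lemma zero_mean_iff: "f \<in> zero_mean N \<longleftrightarrow> f \<in> per_grid N \<and> gsum N f = 0"
  by (simp add: zero_mean_def grid_inner_gsum one_grid_def)

text \<open>Adding the rank-one term \<open>gsum N\<close> to \<open>-\<Delta>\<close> removes the constants from the
  kernel, so that the perturbed system is uniquely solvable.\<close>

lemma neg_laplace_h_surj:
  assumes N: "N \<ge> 1" and h: "mesh L N \<noteq> 0" and w: "w \<in> zero_mean N"
  shows "w \<in> neg_laplace_h L N ` zero_mean N"
proof -
  define G where "G = {1..int N} \<times> {1..int N}"
  \<comment> \<open>\<open>P\<close> extends values on one period periodically, so unknowns indexed
    by the finite set \<open>G\<close> stand for periodic grid functions.\<close>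
  define P where "P x = (\<lambda>i j. x (rep N i, rep N j))" for x :: "int \<times> int \<Rightarrow> real"
  \<comment> \<open>The matrix of the perturbed operator: each \<open>of_bool\<close> picks the
    representative of a stencil point, and the final 1 in every entry is the rank-one term.\<close>
  define A where "A = (\<lambda>(i,j) k. (4 * of_bool ((rep N i, rep N j) = k)
      - of_bool ((rep N (i + 1), rep N j) = k) - of_bool ((rep N (i - 1), rep N j) = k)
      - of_bool ((rep N i, rep N (j + 1)) = k) - of_bool ((rep N i, rep N (j - 1)) = k))
      / (mesh L N)\<^sup>2 + (1::real))"
  have P: "P x \<in> per_grid N" for x
    by (simp add: P_def per_grid_def)
  have sel: "(\<Sum>k\<in>G. of_bool ((rep N i, rep N j) = k) * x k) = P x i j" for i j and x :: "int \<times> int \<Rightarrow> real"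
    using rep_range[OF N] by (simp add: G_def P_def of_bool_def if_distrib[of "\<lambda>c. c * _"] sum.delta cong: if_cong)
  have sumP: "(\<Sum>k\<in>G. x k) = gsum N (P x)" for x
    unfolding G_def gsum_prod by (intro sum.cong) (auto simp: P_def rep_id)
  have A: "(\<Sum>k\<in>G. A (i,j) k * x k) = neg_laplace_h L N (P x) i j + gsum N (P x)" for i j and x :: "int \<times> int \<Rightarrow> real"
  proof -
    have "A (i,j) k * x k = (4 * (of_bool ((rep N i, rep N j) = k) * x k)
      - of_bool ((rep N (i + 1), rep N j) = k) * x k - of_bool ((rep N (i - 1), rep N j) = k) * x k
      - of_bool ((rep N i, rep N (j + 1)) = k) * x k - of_bool ((rep N i, rep N (j - 1)) = k) * x k)
      / (mesh L N)\<^sup>2 + x k" for k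
      unfolding A_def prod.case by (simp only: distrib_right left_diff_distrib times_divide_eq_left mult_1 mult.assoc)
    then have "(\<Sum>k\<in>G. A (i,j) k * x k) = (4 * P x i j - P x (i + 1) j - P x (i - 1) j - P x i (j + 1) - P x i (j - 1))
      / (mesh L N)\<^sup>2 + gsum N (P x)"
      by (simp only: sum.distrib sum_subtractf sum_divide_distrib[symmetric] sum_distrib_left[symmetric] sel sumP)
    also have "\<dots> = neg_laplace_h L N (P x) i j + gsum N (P x)"
      by (simp add: neg_laplace_h_def laplace_h_def minus_divide_left)
    finally show ?thesis .
  qed
  \<comment> \<open>Summing over a period removes the Laplacian and leaves N^2 times the sum of
    \<open>P x\<close>; a zero-sum right-hand side therefore switches the perturbation off.\<close>
  have mean: "gsum N (P x) = 0"
    if "\<And>i j. (i, j) \<in> G \<Longrightarrow> neg_laplace_h L N (P x) i j + gsum N (P x) = v i j" "gsum N v = 0" for x v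
  proof -
    have "gsum N (\<lambda>i j. neg_laplace_h L N (P x) i j + gsum N (P x)) = gsum N v"
      using that(1) by (intro gsum_cong) (auto simp: G_def)
    then show ?thesis
      using N that(2) by (simp add: gsum_add gsum_const gsum_neg_laplace_h[OF P h])
  qed
  obtain x where x: "\<And>p. p \<in> G \<Longrightarrow> (\<Sum>k\<in>G. A p k * x k) = (case p of (i,j) \<Rightarrow> w i j)"
  proof (rule square_system_solvable[of G A "\<lambda>(i,j). w i j"])
    fix x k assume x: "\<And>p. p \<in> G \<Longrightarrow> (\<Sum>k\<in>G. A p k * x k) = 0" and k: "k \<in> G"
    have eq: "neg_laplace_h L N (P x) i j + gsum N (P x) = 0" if "(i, j) \<in> G" for i j
      using x[OF that] by (simp add: A)
    then have m: "gsum N (P x) = 0"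
      by (rule mean[where v = "\<lambda>_ _. 0"]) (simp_all add: gsum_const)
    \<comment> \<open>Testing the homogeneous equation with \<open>P x\<close> gives zero Dirichlet
      energy, so \<open>P x\<close> is constant on the period, and its zero sum makes that constant
      0.\<close>
    have "grid_inner N (neg_laplace_h L N (P x)) (P x) = gsum N (\<lambda>_ _. 0)"
      unfolding grid_inner_gsum using eq by (intro gsum_cong) (simp add: m G_def)
    then have D0: "dirichlet N (P x) (P x) = 0"
      by (simp add: dirichlet_eq_grid_inner[OF P P h] gsum_const)
    define c where "c = P x 1 1"
    have c: "P x i j = c" if "(i, j) \<in> G" for i j
      unfolding c_def using that by (intro dirichlet_zero_imp_constant[OF D0]) (auto simp: G_def)
    have "gsum N (P x) = gsum N (\<lambda>_ _. c)"
      using c by (intro gsum_cong) (simp add: G_def)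
    then have "c = 0" using m N by (simp add: gsum_const)
    then show "x k = 0"
      using c[of "fst k" "snd k"] k by (auto simp: P_def G_def rep_id)
  qed (auto simp: G_def)
  have eq: "neg_laplace_h L N (P x) i j + gsum N (P x) = w i j" if "(i, j) \<in> G" for i j
    using x[OF that] by (simp add: A)
  then have m: "gsum N (P x) = 0"
    by (rule mean) (use w in \<open>simp_all add: zero_mean_iff\<close>)
  have "neg_laplace_h L N (P x) = w"
    using eq w by (intro per_grid_eqI[OF N neg_laplace_h_per_grid[OF P]]) (auto simp: m G_def zero_mean_iff)
  moreover have "P x \<in> zero_mean N" using P m by (simp add: zero_mean_iff)
  ultimately show ?thesis by blast
qed

text \<open>\<open>inv_into\<close> picks a preimage in \<open>zero_mean N\<close> once one exists,
  which is \<open>neg_laplace_h_surj\<close>.\<close>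

lemma inv_neg_laplace_h:
  assumes "N \<ge> 1" "mesh L N \<noteq> 0" "w \<in> zero_mean N"
  shows "inv_neg_laplace_h L N w \<in> zero_mean N"
    and "neg_laplace_h L N (inv_neg_laplace_h L N w) = w"
  unfolding inv_neg_laplace_h_def using neg_laplace_h_surj[OF assms]
  by (rule inv_into_into, rule f_inv_into_f)

text \<open>With w the negative Laplacian of p, summation by parts turns (p | w) into the Dirichlet
  energy of p; its nonnegativity lets squaring undo \<open>sqrt\<close>.\<close>

lemma norm_m1_sq:
  assumes "N \<ge> 1" "mesh L N \<noteq> 0" "w \<in> zero_mean N"
  shows "(norm_m1 L N w)\<^sup>2 = dirichlet N (inv_neg_laplace_h L N w) (inv_neg_laplace_h L N w)"
proof -
  let ?p = "inv_neg_laplace_h L N w"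
  have p: "?p \<in> per_grid N" using inv_neg_laplace_h(1)[OF assms] by (simp add: zero_mean_iff)
  have "(mesh L N)\<^sup>2 * grid_inner N ?p w = dirichlet N ?p ?p"
    using dirichlet_eq_grid_inner[OF p p assms(2)] inv_neg_laplace_h(2)[OF assms]
    by (simp add: grid_inner_commute)
  then show ?thesis
    unfolding norm_m1_def using dirichlet_nonneg[of N ?p] by simp
qed

section \<open>The discrete convolution\<close>

text \<open>The kernel is itself a grid function and the weight h^2 is left out, so that differences
  of a kernel can again serve as kernels.\<close>

definition conv :: "nat \<Rightarrow> grid \<Rightarrow> grid \<Rightarrow> grid" where
  "conv N k f = (\<lambda>i j. gsum N (\<lambda>a b. k a b * f (i - a) (j - b)))"

lemma conv_per_grid:
  assumes "f \<in> per_grid N"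
  shows "conv N k f \<in> per_grid N"
proof -
  have "f (i + int N - a) j = f (i - a) j" "f i (j + int N - a) = f i (j - a)" for i j a
    using per_gridD1[OF assms, of "i - a" j] per_gridD2[OF assms, of i "j - a"]
    by (simp_all add: algebra_simps)
  then show ?thesis by (simp add: per_grid_def conv_def)
qed

lemma conv_diff_right:
  "conv N k (\<lambda>i j. f i j - g i j) i j = conv N k f i j - conv N k g i j"
  by (simp add: conv_def right_diff_distrib gsum_diff)

lemma conv_diff_left:
  "conv N (\<lambda>a b. k a b - k' a b) f i j = conv N k f i j - conv N k' f i j"
  by (simp add: conv_def left_diff_distrib gsum_diff)

text \<open>Reindexing the sum over a period moves the shift onto the kernel. Hence finite
  differences of J * f fall on J, and no regularity of \<open>f\<close> is involved.\<close>

lemma conv_shift: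
  assumes k: "k \<in> per_grid N" and f: "f \<in> per_grid N"
  shows "conv N k f (i + m) (j + n) = conv N (\<lambda>a b. k (a + m) (b + n)) f i j"
proof -
  have "(\<lambda>a b. k a b * f (i + m - a) (j + n - b)) \<in> per_grid N"
  proof -
    have "f (i' - int N) j' = f i' j'" "f i' (j' - int N) = f i' j'" for i' j'
      using per_gridD1[OF f, of "i' - int N" j'] per_gridD2[OF f, of i' "j' - int N"] by simp_all
    then show ?thesis
      using k by (simp add: per_grid_def diff_diff_eq[symmetric])
  qed
  from gsum_shift[OF this, of m n] show ?thesis
    by (simp add: conv_def)
qed

text \<open>After exchanging sums, the kernel multiplies the correlation of \<open>f\<close> and
  \<open>g\<close>, which is periodic in the offset. Reflecting the offset, with an even kernel,
  exchanges the roles of \<open>f\<close> and \<open>g\<close>.\<close>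

lemma conv_self_adjoint:
  assumes k: "k \<in> per_grid N" "\<And>a b. k (- a) (- b) = k a b"
    and f: "f \<in> per_grid N" and g: "g \<in> per_grid N"
  shows "grid_inner N f (conv N k g) = grid_inner N g (conv N k f)"
proof -
  have corr: "(\<lambda>a b. gsum N (\<lambda>i j. f (i + a) (j + b) * g i j)) \<in> per_grid N"
  proof -
    have "f (i + (a + int N)) j = f (i + a) j" "f i (j + (a + int N)) = f i (j + a)" for i j a
      using per_gridD1[OF f, of "i + a" j] per_gridD2[OF f, of i "j + a"]
      by (simp_all add: add.assoc)
    then show ?thesis by (simp add: per_grid_def)
  qed
  have "(\<lambda>i j. f i j * g (i - a) (j - b)) \<in> per_grid N" for a b
    using f per_grid_shift[OF g, of "- a" "- b"] by (simp add: per_grid_def)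
  from gsum_shift[OF this, of a b a b for a b]
  have shift: "gsum N (\<lambda>i j. f i j * g (i - a) (j - b)) = gsum N (\<lambda>i j. f (i + a) (j + b) * g i j)" for a b
    by simp
  have "grid_inner N f (conv N k g) = gsum N (\<lambda>i j. gsum N (\<lambda>a b. k a b * (f i j * g (i - a) (j - b))))"
    by (simp add: grid_inner_gsum conv_def gsum_mult_left[symmetric] ac_simps)
  also have "\<dots> = gsum N (\<lambda>a b. k a b * gsum N (\<lambda>i j. f (i + a) (j + b) * g i j))"
    by (subst gsum_swap) (simp add: gsum_mult_left shift)
  also have "\<dots> = gsum N (\<lambda>a b. k a b * gsum N (\<lambda>i j. f (i - a) (j - b) * g i j))"
  proof -
    have "(\<lambda>a b. k a b * gsum N (\<lambda>i j. f (i + a) (j + b) * g i j)) \<in> per_grid N"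
      using k(1) corr by (simp add: per_grid_def)
    from gsum_reflect[OF this] show ?thesis by (simp add: k(2))
  qed
  also have "\<dots> = gsum N (\<lambda>i j. gsum N (\<lambda>a b. k a b * (f (i - a) (j - b) * g i j)))"
    by (subst gsum_swap) (simp add: gsum_mult_left)
  also have "\<dots> = grid_inner N g (conv N k f)"
    by (simp add: grid_inner_gsum conv_def gsum_mult_left[symmetric] ac_simps)
  finally show ?thesis .
qed

text \<open>Cauchy-Schwarz over the offsets gives one factor N^2; translation invariance makes every
  offset contribute the same sum, which gives the other.\<close>

lemma conv_bound:
  assumes f: "f \<in> per_grid N"
    and k: "\<And>a b. 1 \<le> a \<Longrightarrow> a \<le> int N \<Longrightarrow> 1 \<le> b \<Longrightarrow> b \<le> int N \<Longrightarrow> \<bar>k a b\<bar> \<le> M"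
  shows "gsum N (\<lambda>i j. (conv N k f i j)\<^sup>2) \<le> (real N) ^ 4 * M\<^sup>2 * gsum N (\<lambda>i j. (f i j)\<^sup>2)"
proof -
  have "(\<lambda>i j. (f i j)\<^sup>2) \<in> per_grid N"
    using f by (simp add: per_grid_def)
  from gsum_shift[OF this, of "- a" "- b" for a b]
  have shift: "gsum N (\<lambda>i j. (f (i - a) (j - b))\<^sup>2) = gsum N (\<lambda>i j. (f i j)\<^sup>2)" for a b
    by simp
  have "(conv N k f i j)\<^sup>2 \<le> (real N)\<^sup>2 * gsum N (\<lambda>a b. M\<^sup>2 * (f (i - a) (j - b))\<^sup>2)" for i j
  proof -
    have "(conv N k f i j)\<^sup>2 \<le> (real N)\<^sup>2 * gsum N (\<lambda>a b. (k a b * f (i - a) (j - b))\<^sup>2)"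
      unfolding conv_def by (rule gsum_square_le)
    also have "\<dots> \<le> (real N)\<^sup>2 * gsum N (\<lambda>a b. M\<^sup>2 * (f (i - a) (j - b))\<^sup>2)"
    proof (intro mult_left_mono gsum_mono)
      fix a b assume "1 \<le> a" "a \<le> int N" "1 \<le> b" "b \<le> int N"
      then have "(k a b)\<^sup>2 \<le> M\<^sup>2" using k[of a b] by (intro abs_le_square_iff[THEN iffD1]) linarith
      then show "(k a b * f (i - a) (j - b))\<^sup>2 \<le> M\<^sup>2 * (f (i - a) (j - b))\<^sup>2"
        by (simp add: power_mult_distrib mult_right_mono)
    qed simp
    finally show ?thesis .
  qed
  then have "gsum N (\<lambda>i j. (conv N k f i j)\<^sup>2)
      \<le> gsum N (\<lambda>i j. (real N)\<^sup>2 * gsum N (\<lambda>a b. M\<^sup>2 * (f (i - a) (j - b))\<^sup>2))"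
    by (intro gsum_mono)
  also have "\<dots> = (real N)\<^sup>2 * gsum N (\<lambda>a b. M\<^sup>2 * gsum N (\<lambda>i j. (f i j)\<^sup>2))"
    by (simp only: gsum_mult_left) (subst gsum_swap, simp only: shift)
  also have "\<dots> = (real N) ^ 4 * M\<^sup>2 * gsum N (\<lambda>i j. (f i j)\<^sup>2)"
    by (simp add: gsum_const power2_eq_square power4_eq_xxxx)
  finally show ?thesis .
qed

section \<open>Sampled kernels and the Dirichlet energy of a convolution\<close>

definition kernel_grid :: "real \<Rightarrow> nat \<Rightarrow> (real \<times> real \<Rightarrow> real) \<Rightarrow> grid" where
  "kernel_grid L N J = (\<lambda>k l. J (of_int k * mesh L N, of_int l * mesh L N))"

lemma dconv_eq_conv: "dconv L N J f i j = (mesh L N)\<^sup>2 * conv N (kernel_grid L N J) f i j"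
  by (simp add: dconv_def conv_def gsum_def kernel_grid_def)

lemma dconv_per_grid: "f \<in> per_grid N \<Longrightarrow> dconv L N J f \<in> per_grid N"
  using conv_per_grid[of f N "kernel_grid L N J"] by (simp add: per_grid_def dconv_eq_conv)

lemma kernel_grid_per_grid:
  assumes "N \<ge> 1" "periodic2 L J"
  shows "kernel_grid L N J \<in> per_grid N"
proof -
  have "real N * mesh L N = L" using assms(1) by (simp add: mesh_def)
  then show ?thesis
    using assms(2) by (simp add: per_grid_def kernel_grid_def distrib_right periodic2_def)
qed

lemma kernel_grid_even: "(\<forall>x. J (- x) = J x) \<Longrightarrow> kernel_grid L N J (- a) (- b) = kernel_grid L N J a b"
  by (simp add: kernel_grid_def uminus_Pair[symmetric] del: uminus_Pair)

text \<open>Mean value theorem along the segment in direction \<open>v\<close>: convexity keeps the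
  intermediate point in \<open>S\<close>, where compactness bounds the continuous directional
  derivative.\<close>

lemma C_1_lipschitz_directional:
  assumes "C_k 1 f" "compact S" "convex S"
  shows "\<exists>K>0. \<forall>p s. s \<ge> 0 \<longrightarrow> p \<in> S \<longrightarrow> p + s *\<^sub>R v \<in> S \<longrightarrow> \<bar>f (p + s *\<^sub>R v) - f p\<bar> \<le> K * s"
proof -
  let ?d = "\<lambda>x. frechet_derivative f (at x)"
  have der: "(f has_derivative ?d x) (at x)" for x
    using assms(1) by (simp add: differentiable_on_def frechet_derivative_works[symmetric])
  have "continuous_on S (\<lambda>x. ?d x v)"
    using assms(1) by (auto intro: continuous_on_subset)
  then have "bounded ((\<lambda>x. ?d x v) ` S)"
    using assms(2) by (intro compact_imp_bounded compact_continuous_image)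
  then obtain K where K: "K > 0" "\<And>x. x \<in> S \<Longrightarrow> \<bar>?d x v\<bar> \<le> K"
    by (auto simp: bounded_pos)
  have "\<bar>f (p + s *\<^sub>R v) - f p\<bar> \<le> K * s" if s: "s \<ge> 0" and p: "p \<in> S" "p + s *\<^sub>R v \<in> S" for p s
  proof -
    have "((\<lambda>t. f (p + t *\<^sub>R v)) has_derivative (\<lambda>t. ?d (p + x *\<^sub>R v) (t *\<^sub>R v))) (at x within {0..s})" for x
      by (rule has_derivative_compose[where g = f, OF _ der]) (auto intro!: derivative_eq_intros)
    from mvt_very_simple[OF s this]
    obtain x where x: "x \<in> {0..s}" "f (p + s *\<^sub>R v) - f p = ?d (p + x *\<^sub>R v) (s *\<^sub>R v)"
      by auto
    have "p + x *\<^sub>R v \<in> S"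
    proof (cases "s = 0")
      case False
      \<comment> \<open>The intermediate point as a convex combination of the endpoints; dividing by
        \<open>s\<close> is why \<open>s = 0\<close> is treated apart.\<close>
      have "(1 - x / s) *\<^sub>R p + (x / s) *\<^sub>R (p + s *\<^sub>R v) \<in> S"
        using x False s by (intro convexD[OF assms(3) p]) auto
      also have "(1 - x / s) *\<^sub>R p + (x / s) *\<^sub>R (p + s *\<^sub>R v) = p + x *\<^sub>R v"
        using False by (simp add: algebra_simps)
      finally show ?thesis .
    qed (use x p in auto)
    moreover have "?d (p + x *\<^sub>R v) (s *\<^sub>R v) = s * ?d (p + x *\<^sub>R v) v"
      using linear_scale[OF has_derivative_linear[OF der]] by simp
    ultimately show ?thesis
      using mult_left_mono[OF K(2)[of "p + x *\<^sub>R v"] s] x(2) s by (simp add: abs_mult mult.commute)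
  qed
  with K(1) show ?thesis by blast
qed


text \<open>Differences of the sampled kernel are at most K h, so \<open>conv_bound\<close> gives
  N^4 (K h)^2. With h^4 from the squared weight of \<open>dconv\<close>, N^4 h^4 = L^4 and one h^2
  remains for the norm of \<open>f\<close>, so the constant does not depend on N.\<close>

lemma dirichlet_dconv_le:
  assumes L: "L > 0" and J: "C_k 1 J" "periodic2 L J"
  shows "\<exists>M>0. \<forall>N f. N \<ge> 1 \<longrightarrow> f \<in> per_grid N \<longrightarrow>
    dirichlet N (dconv L N J f) (dconv L N J f) \<le> M * ((mesh L N)\<^sup>2 * grid_inner N f f)"
proof -
  \<comment> \<open>Nodes lie in [0,L], but their forward neighbours reach L + h, which is at most
    2L.\<close>
  let ?S = "{0..2 * L} \<times> {0..2 * L}"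
  have S: "compact ?S" "convex ?S" by (auto intro: compact_Times convex_Times)
  obtain K1 where K1: "K1 > 0" "\<And>p s. s \<ge> 0 \<Longrightarrow> p \<in> ?S \<Longrightarrow> p + s *\<^sub>R (1,0) \<in> ?S \<Longrightarrow> \<bar>J (p + s *\<^sub>R (1,0)) - J p\<bar> \<le> K1 * s"
    using C_1_lipschitz_directional[OF J(1) S, of "(1,0)"] by auto
  obtain K2 where K2: "K2 > 0" "\<And>p s. s \<ge> 0 \<Longrightarrow> p \<in> ?S \<Longrightarrow> p + s *\<^sub>R (0,1) \<in> ?S \<Longrightarrow> \<bar>J (p + s *\<^sub>R (0,1)) - J p\<bar> \<le> K2 * s"
    using C_1_lipschitz_directional[OF J(1) S, of "(0,1)"] by auto
  define M where "M = L ^ 4 * (K1\<^sup>2 + K2\<^sup>2)"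
  have "dirichlet N (dconv L N J f) (dconv L N J f) \<le> M * ((mesh L N)\<^sup>2 * grid_inner N f f)"
    if N: "N \<ge> 1" and f: "f \<in> per_grid N" for N f
  proof -
    define h where "h = mesh L N"
    define k where "k = kernel_grid L N J"
    have h: "0 < h" "real N * h = L" using L N by (simp_all add: h_def mesh_def)
    have kper: "k \<in> per_grid N" unfolding k_def by (rule kernel_grid_per_grid[OF N J(2)])
    have node: "0 \<le> of_int a * h" "of_int a * h \<le> L" "of_int a * h + h \<le> 2 * L"
      if "1 \<le> a" "a \<le> int N" for a
    proof -
      have "of_int a \<le> real N" using that by linarith
      then show "of_int a * h \<le> L" using h by (metis mult_right_mono less_imp_le)
      moreover have "1 * h \<le> real N * h" using N h(1) by (intro mult_right_mono) auto
      ultimately show "of_int a * h + h \<le> 2 * L" using h(2) by simp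
      show "0 \<le> of_int a * h" using that h by simp
    qed
    have k1: "\<bar>k (a + 1) b - k a b\<bar> \<le> K1 * h" and k2: "\<bar>k a (b + 1) - k a b\<bar> \<le> K2 * h"
      if "1 \<le> a" "a \<le> int N" "1 \<le> b" "b \<le> int N" for a b
      using K1(2)[of h "(of_int a * h, of_int b * h)"] K2(2)[of h "(of_int a * h, of_int b * h)"]
        node[of a] node[of b] that h L
      by (auto simp: k_def kernel_grid_def h_def[symmetric] distrib_right)
    let ?d1 = "conv N (\<lambda>a b. k (a + 1) b - k a b) f" and ?d2 = "conv N (\<lambda>a b. k a (b + 1) - k a b) f"
    have d1: "dconv L N J f (i + 1) j - dconv L N J f i j = h\<^sup>2 * ?d1 i j" for i j
      using conv_shift[OF kper f, of i 1 j 0]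
      by (simp add: dconv_eq_conv conv_diff_left h_def k_def right_diff_distrib)
    have d2: "dconv L N J f i (j + 1) - dconv L N J f i j = h\<^sup>2 * ?d2 i j" for i j
      using conv_shift[OF kper f, of i 0 j 1]
      by (simp add: dconv_eq_conv conv_diff_left h_def k_def right_diff_distrib)
    have "dirichlet N (dconv L N J f) (dconv L N J f)
       = h ^ 4 * (gsum N (\<lambda>i j. (?d1 i j)\<^sup>2) + gsum N (\<lambda>i j. (?d2 i j)\<^sup>2))"
      unfolding dirichlet_def d1 d2 gsum_add[symmetric] gsum_mult_left[symmetric]
      by (intro gsum_cong) (simp add: power2_eq_square power4_eq_xxxx algebra_simps)
    also have "\<dots> \<le> h ^ 4 * ((real N) ^ 4 * (K1 * h)\<^sup>2 * gsum N (\<lambda>i j. (f i j)\<^sup>2)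
        + (real N) ^ 4 * (K2 * h)\<^sup>2 * gsum N (\<lambda>i j. (f i j)\<^sup>2))"
      using k1 k2 by (intro mult_left_mono add_mono conv_bound f) auto
    also have "\<dots> = (real N * h) ^ 4 * (K1\<^sup>2 + K2\<^sup>2) * (h\<^sup>2 * gsum N (\<lambda>i j. (f i j)\<^sup>2))"
      by (simp add: power_mult_distrib algebra_simps)
    finally show ?thesis
      unfolding M_def grid_inner_gsum h_def[symmetric] by (simp only: h(2) power2_eq_square)
  qed
  moreover have "M > 0" using L K1(1) K2(1) by (simp add: M_def add_pos_pos)
  ultimately show ?thesis by blast
qed

section \<open>Energy stability\<close>

lemma deriv_potential: "deriv potential r = r ^ 3 - r"
  unfolding potential_def
  by (rule DERIV_imp_deriv) (auto intro!: derivative_eq_intros simp: power2_eq_square power3_eq_cube field_simps)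

text \<open>The part -r^2/2 of the potential cancels exactly against (a - b)^2/2; what remains is
  the convexity gap of r^4/4, a square times a sum of squares.\<close>

lemma potential_diff_le: "potential a - potential b \<le> deriv potential a * (a - b) + (a - b)\<^sup>2 / 2"
proof -
  have "deriv potential a * (a - b) + (a - b)\<^sup>2 / 2 - (potential a - potential b)
      = (a - b)\<^sup>2 * ((a + b)\<^sup>2 + 2 * a\<^sup>2) / 4"
    unfolding deriv_potential potential_def by (simp add: field_simps power2_eq_square power3_eq_cube)
  moreover have "0 \<le> (a - b)\<^sup>2 * ((a + b)\<^sup>2 + 2 * a\<^sup>2) / 4" by simp
  ultimately show ?thesis by linarith
qed

lemma chem_potential_per_grid:
  assumes "a \<in> per_grid N"
  shows "chem_potential L N J \<epsilon> a \<in> per_grid N"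
  using assms dconv_per_grid[OF assms, of L J] by (simp add: per_grid_def chem_potential_def)

text \<open>The quadratic terms are expanded exactly about the new value \<open>a\<close> by q(a) -
  q(b) = 2 B(a,w) - q(w). For the convolution term this needs self-adjointness, hence the evenness
  of \<open>J\<close>.\<close>

lemma energy_h_diff_le:
  assumes N: "N \<ge> 1" and J: "periodic2 L J" "\<forall>x. J (- x) = J x"
    and a: "a \<in> per_grid N" and b: "b \<in> per_grid N"
  defines "w \<equiv> \<lambda>i j. a i j - b i j"
  shows "energy_h L N J \<epsilon> a - energy_h L N J \<epsilon> b
    \<le> (mesh L N)\<^sup>2 * grid_inner N (chem_potential L N J \<epsilon> a) w
      - gamma_disc L N J \<epsilon> / 2 * ((mesh L N)\<^sup>2 * grid_inner N w w)
      + \<epsilon>\<^sup>2 / 2 * ((mesh L N)\<^sup>2 * grid_inner N w (dconv L N J w))"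
proof -
  define c where "c = dconv_one L N J"
  let ?Ja = "dconv L N J a" and ?Jb = "dconv L N J b"
  have sym: "gsum N (\<lambda>i j. a i j * ?Jb i j) = gsum N (\<lambda>i j. b i j * ?Ja i j)"
    using conv_self_adjoint[OF kernel_grid_per_grid[OF N J(1)] kernel_grid_even[OF J(2)] a b]
    by (simp add: grid_inner_gsum dconv_eq_conv mult.left_commute[of _ "(mesh L N)\<^sup>2"] gsum_mult_left)
  have Jw: "dconv L N J w = (\<lambda>i j. ?Ja i j - ?Jb i j)"
    by (intro ext) (simp add: dconv_eq_conv w_def conv_diff_right right_diff_distrib)
  have E: "energy_h L N J \<epsilon> f = (mesh L N)\<^sup>2 * (gsum N (\<lambda>i j. potential (f i j))
     + \<epsilon>\<^sup>2 * c / 2 * gsum N (\<lambda>i j. f i j * f i j) - \<epsilon>\<^sup>2 / 2 * gsum N (\<lambda>i j. f i j * dconv L N J f i j))" for f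
  proof -
    have "0 \<le> gsum N (\<lambda>i j. f i j * f i j)" by (rule gsum_nonneg) simp
    then have "(grid_norm2 L N f)\<^sup>2 = (mesh L N)\<^sup>2 * gsum N (\<lambda>i j. f i j * f i j)"
      by (simp add: grid_norm2_def grid_inner_gsum)
    then show ?thesis
      by (simp add: energy_h_def c_def grid_inner_gsum one_grid_def algebra_simps)
  qed
  have F: "gsum N (\<lambda>i j. potential (a i j)) - gsum N (\<lambda>i j. potential (b i j))
      \<le> gsum N (\<lambda>i j. deriv potential (a i j) * w i j) + gsum N (\<lambda>i j. w i j * w i j) / 2"
    unfolding gsum_add[symmetric] gsum_diff[symmetric] gsum_divide[symmetric] w_def
    using potential_diff_le by (intro gsum_mono) (simp add: power2_eq_square)
  have Q: "gsum N (\<lambda>i j. a i j * a i j) - gsum N (\<lambda>i j. b i j * b i j)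
      = 2 * gsum N (\<lambda>i j. a i j * w i j) - gsum N (\<lambda>i j. w i j * w i j)"
    unfolding gsum_diff[symmetric] gsum_mult_left[symmetric] w_def
    by (intro gsum_cong) (simp add: algebra_simps)
  have C: "gsum N (\<lambda>i j. a i j * ?Ja i j) - gsum N (\<lambda>i j. b i j * ?Jb i j)
      = 2 * gsum N (\<lambda>i j. ?Ja i j * w i j) - gsum N (\<lambda>i j. w i j * dconv L N J w i j)"
    using sym unfolding Jw unfolding w_def by (simp add: left_diff_distrib right_diff_distrib gsum_diff mult.commute)
  have O: "grid_inner N (chem_potential L N J \<epsilon> a) w = gsum N (\<lambda>i j. deriv potential (a i j) * w i j)
      + \<epsilon>\<^sup>2 * c * gsum N (\<lambda>i j. a i j * w i j) - \<epsilon>\<^sup>2 * gsum N (\<lambda>i j. ?Ja i j * w i j)"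
    by (simp add: grid_inner_gsum chem_potential_def c_def left_diff_distrib distrib_right gsum_add gsum_diff
        gsum_mult_left[symmetric] mult.assoc)
  let ?EA = "gsum N (\<lambda>i j. potential (a i j)) + \<epsilon>\<^sup>2 * c / 2 * gsum N (\<lambda>i j. a i j * a i j) - \<epsilon>\<^sup>2 / 2 * gsum N (\<lambda>i j. a i j * ?Ja i j)"
  let ?EB = "gsum N (\<lambda>i j. potential (b i j)) + \<epsilon>\<^sup>2 * c / 2 * gsum N (\<lambda>i j. b i j * b i j) - \<epsilon>\<^sup>2 / 2 * gsum N (\<lambda>i j. b i j * ?Jb i j)"
  have "?EA - ?EB = (gsum N (\<lambda>i j. potential (a i j)) - gsum N (\<lambda>i j. potential (b i j)))
     + \<epsilon>\<^sup>2 * c / 2 * (gsum N (\<lambda>i j. a i j * a i j) - gsum N (\<lambda>i j. b i j * b i j))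
     - \<epsilon>\<^sup>2 / 2 * (gsum N (\<lambda>i j. a i j * ?Ja i j) - gsum N (\<lambda>i j. b i j * ?Jb i j))"
    by (simp only: right_diff_distrib)
  \<comment> \<open>The 1/2 lost in \<open>F\<close> and the term from \<open>Q\<close> combine into
    the coefficient -(\<epsilon>^2 c - 1)/2, that is, minus half of
    \<open>gamma_disc\<close>.\<close>
  also have "\<dots> \<le> grid_inner N (chem_potential L N J \<epsilon> a) w - (\<epsilon>\<^sup>2 * c - 1) / 2 * gsum N (\<lambda>i j. w i j * w i j)
      + \<epsilon>\<^sup>2 / 2 * gsum N (\<lambda>i j. w i j * dconv L N J w i j)"
    unfolding Q C O using F by (simp add: field_simps)
  finally have "(mesh L N)\<^sup>2 * (?EA - ?EB) \<le> (mesh L N)\<^sup>2 * (grid_inner N (chem_potential L N J \<epsilon> a) w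
      - (\<epsilon>\<^sup>2 * c - 1) / 2 * gsum N (\<lambda>i j. w i j * w i j) + \<epsilon>\<^sup>2 / 2 * gsum N (\<lambda>i j. w i j * dconv L N J w i j))"
    by (rule mult_left_mono) simp
  then show ?thesis
    unfolding E gamma_disc_def c_def[symmetric] grid_inner_gsum[of N w] by (simp only: algebra_simps)
qed

section \<open>Energy decay in one time step\<close>

lemma bdf2_energy_step:
  assumes N: "N \<ge> 1" and h: "mesh L N \<noteq> 0" and J: "periodic2 L J" "\<forall>x. J (- x) = J x"
    and M: "M > 0" "\<And>f. f \<in> per_grid N \<Longrightarrow>
      dirichlet N (dconv L N J f) (dconv L N J f) \<le> M * ((mesh L N)\<^sup>2 * grid_inner N f f)"
    and \<epsilon>: "\<epsilon> > 0" and g: "gamma_disc L N J \<epsilon> > 0" and \<tau>: "\<tau> > 0"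
    and le: "\<tau> \<le> 8 * gamma_disc L N J \<epsilon> / (M * \<epsilon> ^ 4)"
    and a: "a \<in> per_grid N" and b: "b \<in> per_grid N" and w: "w = (\<lambda>i j. a i j - b i j)"
    and w0: "w \<in> zero_mean N" and v0: "v \<in> zero_mean N"
    and eq: "\<And>i j. 3 * w i j - v i j = - 2 * \<tau> * neg_laplace_h L N (chem_potential L N J \<epsilon> a) i j"
  shows "modified_energy_h L N J \<epsilon> \<tau> a w \<le> modified_energy_h L N J \<epsilon> \<tau> b v"
proof -
  define H where "H = (mesh L N)\<^sup>2"
  define \<gamma> where "\<gamma> = gamma_disc L N J \<epsilon>"
  define \<omega> where "\<omega> = chem_potential L N J \<epsilon> a"
  let ?p = "inv_neg_laplace_h L N w" and ?q = "inv_neg_laplace_h L N v"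
  let ?G = "H * grid_inner N w (dconv L N J w)" and ?W = "H * grid_inner N w w"
  let ?X = "dirichlet N ?p ?p" and ?V = "dirichlet N ?q ?q" and ?Y = "dirichlet N ?q ?p"
  have per: "?p \<in> per_grid N" "?q \<in> per_grid N" "\<omega> \<in> per_grid N" "w \<in> per_grid N"
    using inv_neg_laplace_h(1)[OF N h] w0 v0 chem_potential_per_grid[OF a]
    by (auto simp: zero_mean_iff \<omega>_def)
  have test_p: "dirichlet N ?p f = H * grid_inner N w f" if "f \<in> per_grid N" for f
    using dirichlet_eq_grid_inner[OF per(1) that h] inv_neg_laplace_h(2)[OF N h w0] by (simp add: H_def)
  have test_q: "dirichlet N ?q f = H * grid_inner N v f" if "f \<in> per_grid N" for f
    using dirichlet_eq_grid_inner[OF per(2) that h] inv_neg_laplace_h(2)[OF N h v0] by (simp add: H_def)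
  \<comment> \<open>The scheme is multiplied by \<open>?p\<close> and summed: \<open>?X\<close> and
    \<open>?Y\<close> are the weighted products of \<open>w\<close> and \<open>v\<close> with
    \<open>?p\<close>, and on the right the Laplacian moves onto \<open>?p\<close>.\<close>
  have "3 * ?X - ?Y = H * gsum N (\<lambda>i j. (3 * w i j - v i j) * ?p i j)"
    by (simp add: test_p test_q per grid_inner_gsum left_diff_distrib mult.assoc gsum_diff gsum_mult_left right_diff_distrib)
  also have "\<dots> = - 2 * \<tau> * (H * grid_inner N (neg_laplace_h L N \<omega>) ?p)"
    unfolding eq \<omega>_def by (simp add: grid_inner_gsum mult.assoc gsum_mult_left gsum_uminus)
  also have "H * grid_inner N (neg_laplace_h L N \<omega>) ?p = dirichlet N \<omega> ?p"
    using dirichlet_eq_grid_inner[OF per(3,1) h] by (simp add: H_def)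
  also have "\<dots> = H * grid_inner N \<omega> w"
    by (simp add: dirichlet_commute[of N \<omega>] test_p per grid_inner_commute)
  finally have scheme: "3 * ?X - ?Y = - 2 * \<tau> * (H * grid_inner N \<omega> w)" .
  have "?Y \<le> ?X / 2 + ?V / 2"
    using dirichlet_Young[of 1 N ?q ?p] by simp
  with scheme have "2 * \<tau> * (H * grid_inner N \<omega> w) \<le> ?V / 2 - 5 / 2 * ?X" by simp
  then have O: "H * grid_inner N \<omega> w \<le> ?V / (4 * \<tau>) - 5 * ?X / (4 * \<tau>)"
    using \<tau> by (simp add: field_simps)
  \<comment> \<open>Chosen so that the \<open>?W\<close> term becomes exactly \<gamma>/2 times
    \<open>?W\<close>; the coefficient of \<open>?X\<close> is then \<epsilon>^4 M/(8 \<gamma>),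
    which the step-size bound makes at most 1/\<tau>.\<close>
  define s where "s = \<epsilon>\<^sup>2 * M / (2 * \<gamma>)"
  have s: "s > 0" using M(1) \<epsilon> g by (simp add: s_def \<gamma>_def)
  have "?G = dirichlet N ?p (dconv L N J w)"
    by (simp add: test_p dconv_per_grid per)
  also have "\<dots> \<le> s / 2 * ?X + 1 / (2 * s) * dirichlet N (dconv L N J w) (dconv L N J w)"
    by (rule dirichlet_Young[OF s])
  also have "\<dots> \<le> s / 2 * ?X + 1 / (2 * s) * (M * ?W)"
    using M(2)[OF per(4)] s by (intro add_mono mult_left_mono) (auto simp: H_def)
  finally have "\<epsilon>\<^sup>2 / 2 * ?G \<le> \<epsilon>\<^sup>2 / 2 * (s / 2 * ?X + 1 / (2 * s) * (M * ?W))"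
    by (rule mult_left_mono) simp
  also have "\<dots> = \<epsilon> ^ 4 * M / (8 * \<gamma>) * ?X + \<gamma> / 2 * ?W"
    using M(1) \<epsilon> g unfolding s_def \<gamma>_def by (simp add: field_simps power2_eq_square power4_eq_xxxx)
  also have "\<dots> \<le> 1 / \<tau> * ?X + \<gamma> / 2 * ?W"
  proof -
    have "\<epsilon> ^ 4 * M / (8 * \<gamma>) \<le> 1 / \<tau>"
      using le \<tau> M(1) \<epsilon> g by (simp add: \<gamma>_def field_simps)
    then show ?thesis
      using dirichlet_nonneg[of N ?p] by (intro add_right_mono mult_right_mono)
  qed
  finally have G: "\<epsilon>\<^sup>2 / 2 * ?G \<le> ?X / \<tau> + \<gamma> / 2 * ?W" by simp
  have "energy_h L N J \<epsilon> a - energy_h L N J \<epsilon> b \<le> H * grid_inner N \<omega> w - \<gamma> / 2 * ?W + \<epsilon>\<^sup>2 / 2 * ?G"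
    using energy_h_diff_le[OF N J a b] by (simp add: w H_def \<gamma>_def \<omega>_def)
  then have "energy_h L N J \<epsilon> a - energy_h L N J \<epsilon> b \<le> ?V / (4 * \<tau>) - 5 * ?X / (4 * \<tau>) + ?X / \<tau>"
    using O G by linarith
  \<comment> \<open>Of the 5/4 copies of \<open>?X\<close> over \<tau>, one has absorbed the
    convolution term; the remaining quarter is the weight in the modified energy.\<close>
  also have "\<dots> = ?V / (4 * \<tau>) - ?X / (4 * \<tau>)"
    using \<tau> by (simp add: field_simps)
  finally show ?thesis
    unfolding modified_energy_h_def norm_m1_sq[OF N h w0] norm_m1_sq[OF N h v0] by simp
qed

section \<open>Assembly along the sequence of time steps\<close>

theorem theorem4p2:
  fixes L :: real and J :: "real \<times> real \<Rightarrow> real"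
  assumes "L > 0"
    and "smooth J" and "periodic2 L J" and "\<forall>x. J (- x) = J x"
    and "conv_one L J > 0"
  shows "\<exists>C\<^sub>J>0. \<forall>(N::nat) (\<epsilon>::real) (\<tau>::real) (u :: nat \<Rightarrow> grid).
    N \<ge> 1 \<longrightarrow> \<epsilon> > 0 \<longrightarrow> gamma_cont L J \<epsilon> > 0 \<longrightarrow> gamma_disc L N J \<epsilon> > 0 \<longrightarrow>
    \<tau> > 0 \<longrightarrow> \<tau> \<le> 2 * gamma_disc L N J \<epsilon> / (C\<^sub>J * \<epsilon> ^ 4) \<longrightarrow>
    (\<forall>n. u n \<in> per_grid N) \<longrightarrow>
    grid_inner N (u 1) one_grid = grid_inner N (u 0) one_grid \<longrightarrow>
    (\<forall>n\<ge>1. bdf2_step L N J \<epsilon> \<tau> u n) \<longrightarrow>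
    (\<forall>n\<ge>1. modified_energy_h L N J \<epsilon> \<tau> (u (n + 1)) (delta u (n + 1))
             \<le> modified_energy_h L N J \<epsilon> \<tau> (u n) (delta u n))"
proof -
  have "C_k 1 J" using assms(2) by (simp only: smooth_def)
  from dirichlet_dconv_le[OF assms(1) this assms(3)]
  obtain M where M: "M > 0" "\<And>N f. N \<ge> 1 \<Longrightarrow> f \<in> per_grid N \<Longrightarrow>
    dirichlet N (dconv L N J f) (dconv L N J f) \<le> M * ((mesh L N)\<^sup>2 * grid_inner N f f)"
    by blast
  show ?thesis
  proof (intro exI[of _ "M / 4"] conjI allI impI)
    show "M / 4 > 0" using M(1) by simp
  next
    fix N :: nat and \<epsilon> \<tau> :: real and u :: "nat \<Rightarrow> grid" and n :: nat
    assume N: "N \<ge> 1" and \<epsilon>: "\<epsilon> > 0" and g: "gamma_disc L N J \<epsilon> > 0" and \<tau>: "\<tau> > 0"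
      and le: "\<tau> \<le> 2 * gamma_disc L N J \<epsilon> / (M / 4 * \<epsilon> ^ 4)"
      and u: "\<forall>n. u n \<in> per_grid N"
      and mean: "grid_inner N (u 1) one_grid = grid_inner N (u 0) one_grid"
      and bdf2: "\<forall>n\<ge>1. bdf2_step L N J \<epsilon> \<tau> u n" and n: "n \<ge> 1"
    have h: "mesh L N \<noteq> 0" using N assms(1) by (simp add: mesh_def)
    have d_per: "delta u m \<in> per_grid N" for m
      using u by (simp add: delta_def per_grid_def)
    \<comment> \<open>The BDF2 difference 3a - 4b + c equals 3(a - b) - (b - c), so the scheme
      involves increments only.\<close>
    have eq: "3 * delta u (m + 1) i j - delta u m i j
        = - 2 * \<tau> * neg_laplace_h L N (chem_potential L N J \<epsilon> (u (m + 1))) i j" if "m \<ge> 1" for m i j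
    proof -
      have "(3 * u (m + 1) i j - 4 * u m i j + u (m - 1) i j) / (2 * \<tau>)
          = - neg_laplace_h L N (chem_potential L N J \<epsilon> (u (m + 1))) i j"
        using bdf2 that by (simp add: bdf2_step_def neg_laplace_h_def)
      then show ?thesis using \<tau> by (simp add: delta_def field_simps)
    qed
    \<comment> \<open>Equal initial means give the case 1. Summing the scheme removes the Laplacian,
      so three times the next sum equals the current one, and zero mean propagates.\<close>
    have zm: "delta u m \<in> zero_mean N" if "m \<ge> 1" for m
      using that
    proof (induction m rule: dec_induct)
      case base
      then show ?case
        using mean d_per[of 1] by (simp add: zero_mean_iff delta_def grid_inner_gsum one_grid_def gsum_diff)
    next
      case (step m)
      have "gsum N (\<lambda>i j. 3 * delta u (m + 1) i j - delta u m i j) = 0"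
        unfolding eq[OF step(1)] gsum_mult_left
        by (simp add: gsum_neg_laplace_h[OF chem_potential_per_grid h] u)
      then show ?case
        using step(3) d_per[of "Suc m"] by (simp add: zero_mean_iff gsum_diff gsum_mult_left)
    qed
    show "modified_energy_h L N J \<epsilon> \<tau> (u (n + 1)) (delta u (n + 1))
        \<le> modified_energy_h L N J \<epsilon> \<tau> (u n) (delta u n)"
    proof (rule bdf2_energy_step[OF N h assms(3,4) M(1) M(2)[OF N] \<epsilon> g \<tau>])
      show "\<tau> \<le> 8 * gamma_disc L N J \<epsilon> / (M * \<epsilon> ^ 4)" using le by (simp add: field_simps)
      show "delta u (n + 1) = (\<lambda>i j. u (n + 1) i j - u n i j)" by (simp add: delta_def)
    qed (use u zm n eq in auto)
  qed
qed

end
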